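(* Let $B\in \mathrm{M}_3(\mathbb{R})$ be a skew-symmetrizable and cyclic matrix, written as $$B=\begin{pmatrix}0&-z'&y\\ z&0&-x'\\ -y'&x&0\end{pmatrix},\qquad x,y,z,x',y',z'\in\mathbb{R},\ xyz=x'y'z'.$$ Define its Markov constant $C(B)=xx'+yy'+zz'-|xyz|$. Then the following are equivalent: (1) $B$ is cluster-cyclic; (2) $C(B)\le 4$ and $xx'\ge 4$, $yy'\ge 4$, $zz'\ge 4$.
   Context: A matrix $B\in\mathrm{M}_3(\mathbb{R})$ is skew-symmetrizable if there is a diagonal matrix $D$ with positive diagonal entries such that $DB$ is skew-symmetric; every such $B$ can be written in the displayed form with $xyz=x'y'z'$, where $x,x'$ have the same sign, $y,y'$ have the same sign and $z,z'$ have the same sign. For $k\in\{1,2,3\}$ the mutation $\mu_k(B)=(b'_{ij})$ of $B=(b_{ij})$ is defined by $b'_{ij}=-b_{ij}$ if $i=k$ or $j=k$, and $b'_{ij}=b_{ij}+b_{ik}[b_{kj}]_++[-b_{ik}]_+b_{kj}$ otherwise, where $[a]_+=\max(a,0)$; mutations preserve skew-symmetrizability. A skew-symmetrizable $B$ of the displayed form is cyclic if the six numbers $x,y,z,x',y',z'$ are either all positive or all negative. $B$ is cluster-cyclic if every matrix obtained from $B$ by applying finitely many mutations (in any order) is cyclic. *)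

theory Defs
  imports "HOL-Analysis.Analysis"
begin

definition skew_symmetrizable :: "real^3^3 \<Rightarrow> bool" where
  "skew_symmetrizable B \<longleftrightarrow>
     (\<exists>D :: real^3^3. (\<forall>i j. i \<noteq> j \<longrightarrow> D $ i $ j = 0) \<and> (\<forall>i. D $ i $ i > 0) \<and>
        transpose (D ** B) = - (D ** B))"

definition exchange_matrix :: "real \<Rightarrow> real \<Rightarrow> real \<Rightarrow> real \<Rightarrow> real \<Rightarrow> real \<Rightarrow> real^3^3" where
  "exchange_matrix x y z x' y' z' =
     vector [vector [0, - z', y],
             vector [z, 0, - x'],
             vector [- y', x, 0]]"

definition pos_part :: "real \<Rightarrow> real" where
  "pos_part a = max a 0"

definition mutation :: "3 \<Rightarrow> real^3^3 \<Rightarrow> real^3^3" where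
  "mutation k B = (\<chi> i j.
     if i = k \<or> j = k then - (B $ i $ j)
     else B $ i $ j + B $ i $ k * pos_part (B $ k $ j) + pos_part (- (B $ i $ k)) * B $ k $ j)"

inductive mutation_equivalent :: "real^3^3 \<Rightarrow> real^3^3 \<Rightarrow> bool" for B where
  refl: "mutation_equivalent B B"
| step: "mutation_equivalent B B' \<Longrightarrow> mutation_equivalent B (mutation k B')"

definition cyclic :: "real^3^3 \<Rightarrow> bool" where
  "cyclic B \<longleftrightarrow> skew_symmetrizable B \<and>
     (\<exists>x y z x' y' z'. B = exchange_matrix x y z x' y' z' \<and>
        ((x > 0 \<and> y > 0 \<and> z > 0 \<and> x' > 0 \<and> y' > 0 \<and> z' > 0) \<or>
         (x < 0 \<and> y < 0 \<and> z < 0 \<and> x' < 0 \<and> y' < 0 \<and> z' < 0)))"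

definition cluster_cyclic :: "real^3^3 \<Rightarrow> bool" where
  "cluster_cyclic B \<longleftrightarrow> (\<forall>B'. mutation_equivalent B B' \<longrightarrow> cyclic B')"

text \<open>The entries of an \<open>exchange_matrix\<close> determine its parameters; see the lemma below.\<close>

definition markov_constant :: "real^3^3 \<Rightarrow> real" where
  "markov_constant B =
     (let x = B $ 3 $ 2; y = B $ 1 $ 3; z = B $ 2 $ 1;
          x' = - (B $ 2 $ 3); y' = - (B $ 3 $ 1); z' = - (B $ 1 $ 2)
      in x * x' + y * y' + z * z' - \<bar>x * y * z\<bar>)"

lemma markov_constant_exchange_matrix:
  "markov_constant (exchange_matrix x y z x' y' z') = x * x' + y * y' + z * z' - \<bar>x * y * z\<bar>"
  by (simp add: markov_constant_def exchange_matrix_def Let_def vector_3)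

end

theory Submission
  imports Defs
begin

text \<open>
  A positive diagonal conjugation turns \<open>B\<close> into a skew-symmetric matrix with entries
  \<open>\<plusminus>p, \<plusminus>q, \<plusminus>r\<close>, where \<open>p\<^sup>2 = xx'\<close>, \<open>q\<^sup>2 = yy'\<close>, \<open>r\<^sup>2 = zz'\<close>, and this commutes with mutation. As long
  as all matrices are cyclic, mutation acts on triples by \<open>p \<mapsto> p' = qr - p\<close> and its two analogues,
  and \<open>C = p\<^sup>2 + q\<^sup>2 + r\<^sup>2 - pqr\<close> is invariant. Everything rests on the identity
  \<open>(p - 2)(p' - 2) = (q - r)\<^sup>2 + 4 - C\<close>. It shows that \<open>p, q, r \<ge> 2\<close>, \<open>C \<le> 4\<close> is preserved.
  Conversely, if \<open>p < 2\<close>, then alternating the two mutations fixing \<open>p\<close> lowers the ratio of \<open>q\<close> and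
  \<open>r\<close> by at least \<open>2 - p\<close> each time, so positivity fails eventually. If \<open>p, q, r \<ge> 2\<close> throughout but
  \<open>C > 4\<close>, the identity keeps any two of the three numbers at distance at least \<open>sqrt (C - 4)\<close>, and
  mutating the largest one lowers it by at least this amount, which cannot go on forever.
\<close>

section \<open>Mutation of triples\<close>

definition markov_form :: "real \<Rightarrow> real \<Rightarrow> real \<Rightarrow> real" where
  "markov_form p q r = p\<^sup>2 + q\<^sup>2 + r\<^sup>2 - p * q * r"

lemma markov_form_swap: "markov_form q p r = markov_form p q r"
  "markov_form p r q = markov_form p q r"
  by (simp_all add: markov_form_def)

lemma markov_form_mutate: "markov_form (q * r - p) q r = markov_form p q r"
  by (simp add: markov_form_def power2_eq_square algebra_simps)

lemma markov_form_mutate': "markov_form p (p * r - q) r = markov_form p q r"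
  "markov_form p q (p * q - r) = markov_form p q r"
  by (simp_all add: markov_form_def power2_eq_square algebra_simps)

text \<open>For fixed \<open>q\<close>, \<open>r\<close> and C, the numbers \<open>p\<close> and
  \<open>q * r - p\<close> are the roots of t^2 - q r t + q^2 + r^2 - C; both sides are its value at
  t = 2.\<close>

lemma markov_form_vieta:
  "(p - 2) * ((q * r - p) - 2) = (q - r)\<^sup>2 + 4 - markov_form p q r"
  by (simp add: markov_form_def power2_eq_square algebra_simps)

lemma two_le_mutate:
  assumes "2 \<le> p" "2 \<le> q" "2 \<le> r" "markov_form p q r \<le> 4"
  shows "2 \<le> q * r - p"
\<comment> \<open>At \<open>p = 2\<close> the left side of the identity vanishes and says nothing
  about \<open>q * r - p\<close>.\<close>
proof (cases "p = 2")
  case True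
  have "2 * 2 \<le> q * r" using assms by (intro mult_mono) auto
  then show ?thesis using True by simp
next
  case False
  have "0 \<le> (p - 2) * ((q * r - p) - 2)"
    unfolding markov_form_vieta using assms(4) zero_le_power2[of "q - r"] by linarith
  then show ?thesis using False assms(1) by (simp add: zero_le_mult_iff)
qed

text \<open>Keeping \<open>P\<close> abstract separates the descent arguments from matrices and
  allows permuting coordinates.\<close>

definition positive_mutation_closed :: "(real \<Rightarrow> real \<Rightarrow> real \<Rightarrow> bool) \<Rightarrow> bool" where
  "positive_mutation_closed P \<longleftrightarrow> (\<forall>p q r. P p q r \<longrightarrow> 0 < p \<and> 0 < q \<and> 0 < r \<and>
     P (q * r - p) q r \<and> P p (p * r - q) r \<and> P p q (p * q - r))"

lemma positive_mutation_closed_swap: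
  assumes "positive_mutation_closed P"
  shows "positive_mutation_closed (\<lambda>p q r. P q p r)"
    and "positive_mutation_closed (\<lambda>p q r. P r q p)"
  using assms unfolding positive_mutation_closed_def by (metis mult.commute)+

lemma positive_mutation_closed_ge_two:
  assumes "positive_mutation_closed P" "P p q r"
  shows "2 \<le> p"
proof (rule ccontr)
  assume "\<not> 2 \<le> p"
  define d where "d = 2 - p"
  have d: "0 < d" using \<open>\<not> 2 \<le> p\<close> by (simp add: d_def)
  \<comment> \<open>For t = r/q, mutating \<open>q\<close> gives the ratio p - 1/t, which is at most
    t - d because t + 1/t >= 2. The disjunction records that the two coordinates alternate
    roles.\<close>
  have False if "P p q r \<or> P p r q" "r \<le> real n * d * q" for q r n
    using that
  proof (induction n arbitrary: q r)
    case 0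
    then have "0 < r" using assms(1) unfolding positive_mutation_closed_def by blast
    then show ?case using 0 by simp
  next
    case (Suc n)
    have pos: "0 < q" "0 < r"
      and next_triple: "P p r (p * r - q) \<or> P p (p * r - q) r"
      using Suc.prems(1) assms(1) unfolding positive_mutation_closed_def by blast+
    have "r * r \<le> (real (Suc n) * d * q) * r"
      using Suc.prems(2) pos by (intro mult_right_mono) auto
    moreover have "0 \<le> (q - r)\<^sup>2" by simp
    ultimately have "(p * r - q) * q \<le> (real n * d * r) * q"
      by (simp add: d_def power2_eq_square algebra_simps)
    then have "p * r - q \<le> real n * d * r" using pos by simp
    then show ?case using Suc.IH next_triple by blast
  qed
  moreover obtain n :: nat where "r / (d * q) \<le> real n"
    using real_arch_simple by blast
  moreover have "0 < q" using assms unfolding positive_mutation_closed_def by blast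
  ultimately show False using assms(2) d by (simp add: pos_divide_le_eq mult.assoc) blast
qed

lemma positive_mutation_closed_all_ge_two:
  assumes "positive_mutation_closed P" "P p q r"
  shows "2 \<le> p" "2 \<le> q" "2 \<le> r"
  using positive_mutation_closed_ge_two[OF assms(1)]
    positive_mutation_closed_ge_two[OF positive_mutation_closed_swap(1)[OF assms(1)]]
    positive_mutation_closed_ge_two[OF positive_mutation_closed_swap(2)[OF assms(1)]] assms(2)
  by blast+

text \<open>The quadratic with roots \<open>p\<close> and \<open>q * r - p\<close> is negative at
  \<open>q\<close>, so \<open>q\<close> lies strictly between these roots.\<close>

lemma mutate_largest_less:
  assumes "2 \<le> r" "r \<le> q" "q \<le> p" "4 < markov_form p q r"
  shows "q * r - p < q"
proof -
  have "q\<^sup>2 * (2 - r) \<le> r\<^sup>2 * (2 - r)"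
    using assms by (intro mult_right_mono_neg power_mono) auto
  \<comment> \<open>This product is r^3 - 3 r^2 + 4, so r^2 (2 - r) + r^2 is at most 4.\<close>
  moreover have "0 \<le> (r - 2)\<^sup>2 * (r + 1)" using assms by simp
  ultimately have "q\<^sup>2 * (2 - r) + r\<^sup>2 \<le> 4"
    by (simp add: power2_eq_square algebra_simps)
  moreover have "(q - p) * (q - (q * r - p)) = q\<^sup>2 * (2 - r) + r\<^sup>2 - markov_form p q r"
    by (simp add: markov_form_def power2_eq_square algebra_simps)
  ultimately have "(q - p) * (q - (q * r - p)) < 0" using assms(4) by linarith
  then show ?thesis using assms(3) by (auto simp: mult_less_0_iff)
qed

text \<open>The mutated value falls below the larger of \<open>q\<close> and \<open>r\<close>, which
  is already at least \<open>e\<close> below \<open>p\<close>.\<close>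

lemma mutate_largest_le:
  assumes "2 \<le> q" "2 \<le> r" "q \<le> p" "r \<le> p" "4 < markov_form p q r"
    and "e \<le> \<bar>p - q\<bar>" "e \<le> \<bar>p - r\<bar>"
  shows "q * r - p \<le> p - e"
proof (cases "r \<le> q")
  case True
  then show ?thesis using mutate_largest_less[of r q p] assms by auto
next
  case False
  then show ?thesis using mutate_largest_less[of q r p] assms
    by (auto simp: markov_form_swap mult.commute)
qed

lemma positive_mutation_closed_markov_form_le:
  assumes "positive_mutation_closed P" "P p q r"
  shows "markov_form p q r \<le> 4"
proof (rule ccontr)
  assume "\<not> markov_form p q r \<le> 4"
  define e where "e = sqrt (markov_form p q r - 4)"
  have e: "0 < e" and form: "markov_form p q r = 4 + e\<^sup>2"
    using \<open>\<not> markov_form p q r \<le> 4\<close> by (simp_all add: e_def)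
  note ge_two = positive_mutation_closed_all_ge_two[OF assms(1)]
  have closed: "P (q * r - p) q r" "P p (p * r - q) r" "P p q (p * q - r)" if "P p q r" for p q r
    using assms(1) that by (auto simp: positive_mutation_closed_def)
  have gap: "e \<le> \<bar>q - r\<bar>"
    if "2 \<le> p" "2 \<le> q * r - p" "markov_form p q r = 4 + e\<^sup>2" for p q r
  proof -
    have "0 \<le> (p - 2) * ((q * r - p) - 2)" using that by simp
    then have "e\<^sup>2 \<le> (q - r)\<^sup>2" using markov_form_vieta[of p q r] that(3) by simp
    then show ?thesis using e by (simp add: abs_le_square_iff[symmetric])
  qed
  \<comment> \<open>Induction on the number of steps of size \<open>e\<close> that fit below the
    sum: mutating the largest entry uses up one of them and keeps the form, while a positive sum
    cannot reach \<open>n = 0\<close>.\<close>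
  have False if "P p q r" "markov_form p q r = 4 + e\<^sup>2" "p + q + r \<le> real n * e" for p q r n
    using that
  proof (induction n arbitrary: p q r)
    case 0
    then show ?case using ge_two[of p q r] by simp
  next
    case (Suc n)
    note P = Suc.prems(1) and form = Suc.prems(2)
    note ge = ge_two[OF P]
    have gaps: "e \<le> \<bar>q - r\<bar>" "e \<le> \<bar>p - r\<bar>" "e \<le> \<bar>p - q\<bar>"
      using gap[of p q r] gap[of q p r] gap[of r p q] ge form ge_two closed[OF P]
      by (auto simp: markov_form_swap)
    have gt: "4 < markov_form p q r" using form e by simp
    have sum: "p + q + r \<le> real n * e + e" using Suc.prems(3) by (simp add: algebra_simps)
    consider "q \<le> p" "r \<le> p" | "p \<le> q" "r \<le> q" | "p \<le> r" "q \<le> r" by linarith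
    then show ?case
    proof cases
      case 1
      then have "q * r - p \<le> p - e" using mutate_largest_le[of q r p e] ge gaps gt by simp
      then show ?thesis using Suc.IH[OF closed(1)[OF P]] form sum
        by (simp add: markov_form_mutate)
    next
      case 2
      then have "p * r - q \<le> q - e"
        using mutate_largest_le[of p r q e] ge gaps gt
        by (simp add: markov_form_swap abs_minus_commute)
      then show ?thesis using Suc.IH[OF closed(2)[OF P]] form sum
        by (simp add: markov_form_mutate')
    next
      case 3
      then have "p * q - r \<le> r - e"
        using mutate_largest_le[of p q r e] ge gaps gt
        by (simp add: markov_form_swap abs_minus_commute)
      then show ?thesis using Suc.IH[OF closed(3)[OF P]] form sum
        by (simp add: markov_form_mutate')
    qed
  qed
  moreover obtain n :: nat where "(p + q + r) / e \<le> real n"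
    using real_arch_simple by blast
  ultimately show False using assms(2) form e by (simp add: pos_divide_le_eq) blast
qed

section \<open>Conjugates of skew-symmetric matrices\<close>

text \<open>With \<open>s = \<plusminus>1\<close> and \<open>u * v * w = 1\<close>, the matrix below is conjugate by a positive diagonal matrix
  to the skew-symmetric matrix with parameters \<open>s * p\<close>, \<open>s * q\<close>, \<open>s * r\<close>.\<close>

definition weighted_exchange ::
    "real \<Rightarrow> real \<Rightarrow> real \<Rightarrow> real \<Rightarrow> real \<Rightarrow> real \<Rightarrow> real \<Rightarrow> real^3^3" where
  "weighted_exchange u v w s p q r =
     exchange_matrix (s * p * u) (s * q * v) (s * r * w) (s * p / u) (s * q / v) (s * r / w)"

lemma exchange_matrix_nth [simp]:
  "exchange_matrix x y z x' y' z' $ 1 $ 1 = 0" "exchange_matrix x y z x' y' z' $ 1 $ 2 = - z'"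
  "exchange_matrix x y z x' y' z' $ 1 $ 3 = y" "exchange_matrix x y z x' y' z' $ 2 $ 1 = z"
  "exchange_matrix x y z x' y' z' $ 2 $ 2 = 0" "exchange_matrix x y z x' y' z' $ 2 $ 3 = - x'"
  "exchange_matrix x y z x' y' z' $ 3 $ 1 = - y'" "exchange_matrix x y z x' y' z' $ 3 $ 2 = x"
  "exchange_matrix x y z x' y' z' $ 3 $ 3 = 0"
  by (simp_all add: exchange_matrix_def vector_3)

lemma exchange_matrix_eq_iff:
  "exchange_matrix x y z x' y' z' = exchange_matrix a b c a' b' c' \<longleftrightarrow>
     x = a \<and> y = b \<and> z = c \<and> x' = a' \<and> y' = b' \<and> z' = c'"
  by (auto simp: vec_eq_iff forall_3)

lemma cyclic_exchange_matrix_iff: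
  "cyclic (exchange_matrix x y z x' y' z') \<longleftrightarrow>
     skew_symmetrizable (exchange_matrix x y z x' y' z') \<and>
     ((x > 0 \<and> y > 0 \<and> z > 0 \<and> x' > 0 \<and> y' > 0 \<and> z' > 0) \<or>
      (x < 0 \<and> y < 0 \<and> z < 0 \<and> x' < 0 \<and> y' < 0 \<and> z' < 0))"
  unfolding cyclic_def exchange_matrix_eq_iff by blast

lemma skew_symmetrizable_exchange_matrix:
  assumes "0 < a" "0 < b" "0 < c" "c * x = b * x'" "a * y = c * y'" "b * z = a * z'"
  shows "skew_symmetrizable (exchange_matrix x y z x' y' z')"
  unfolding skew_symmetrizable_def
proof (intro exI conjI)
  let ?D = "vector [vector [a, 0, 0], vector [0, b, 0], vector [0, 0, c]] :: real^3^3"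
  show "\<forall>i j. i \<noteq> j \<longrightarrow> ?D $ i $ j = 0" "\<forall>i. 0 < ?D $ i $ i"
    using assms by (simp_all add: forall_3)
  show "transpose (?D ** exchange_matrix x y z x' y' z') =
      - (?D ** exchange_matrix x y z x' y' z')"
    using assms
    by (simp add: vec_eq_iff forall_3 transpose_def matrix_matrix_mult_def sum_3)
qed

lemma pos_part_pos: "0 < a \<Longrightarrow> pos_part a = a"
  and pos_part_neg: "0 < a \<Longrightarrow> pos_part (- a) = 0"
  by (simp_all add: pos_part_def)

text \<open>With a and b an opposite pair of parameters such as \<open>z'\<close> and
  \<open>z\<close>, these equalities make the two terms added to a diagonal entry by mutation
  cancel.\<close>

lemma mult_pos_part_same_sign:
  assumes "0 < a * b"
  shows "a * pos_part b = pos_part a * b" "a * pos_part (- b) = pos_part (- a) * b"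
  using assms by (auto simp: pos_part_def max_def zero_less_mult_iff)

text \<open>Without the sign hypotheses, mutation would create nonzero diagonal entries.\<close>

lemma mutation_exchange_matrix:
  assumes "0 < x * x'" "0 < y * y'" "0 < z * z'"
  shows "mutation 1 (exchange_matrix x y z x' y' z') =
     exchange_matrix (x - y' * pos_part (- z') - pos_part y' * z') (- y) (- z)
       (x' - z * pos_part y - pos_part (- z) * y) (- y') (- z')"
  "mutation 2 (exchange_matrix x y z x' y' z') =
     exchange_matrix (- x) (y - z' * pos_part (- x') - pos_part z' * x') (- z)
       (- x') (y' - x * pos_part z - pos_part (- x) * z) (- z')"
  "mutation 3 (exchange_matrix x y z x' y' z') =
     exchange_matrix (- x) (- y) (z - x' * pos_part (- y') - pos_part x' * y')
       (- x') (- y') (z' - y * pos_part x - pos_part (- y) * x)"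
  using assms[THEN mult_pos_part_same_sign(1)] assms[THEN mult_pos_part_same_sign(2)]
  by (simp_all add: vec_eq_iff forall_3 mutation_def algebra_simps)

context
  fixes u v w :: real
  assumes weights: "0 < u" "0 < v" "0 < w" "u * v * w = 1"
begin

lemma mutation_weighted_exchange:
  assumes "s = 1 \<or> s = - 1" "0 < p" "0 < q" "0 < r"
  shows "mutation 1 (weighted_exchange u v w s p q r) =
      weighted_exchange u v w (- s) (q * r - p) q r"
    and "mutation 2 (weighted_exchange u v w s p q r) =
      weighted_exchange u v w (- s) p (p * r - q) r"
    and "mutation 3 (weighted_exchange u v w s p q r) =
      weighted_exchange u v w (- s) p q (p * q - r)"
proof -
  \<comment> \<open>The relation between the weights turns q r / (v w) into q r u, so that the
    mutated entry keeps its weight.\<close>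
  have w: "w = 1 / (u * v)" using weights by (simp add: field_simps)
  show "mutation 1 (weighted_exchange u v w s p q r) =
      weighted_exchange u v w (- s) (q * r - p) q r"
    "mutation 2 (weighted_exchange u v w s p q r) =
      weighted_exchange u v w (- s) p (p * r - q) r"
    "mutation 3 (weighted_exchange u v w s p q r) =
      weighted_exchange u v w (- s) p q (p * q - r)"
    unfolding weighted_exchange_def
    by (subst mutation_exchange_matrix;
        use assms weights in \<open>auto simp: exchange_matrix_eq_iff pos_part_pos pos_part_neg\<close>;
        simp add: w field_simps)+
qed

lemma cyclic_weighted_exchange:
  assumes "s = 1 \<or> s = - 1" "0 < p" "0 < q" "0 < r"
  shows "cyclic (weighted_exchange u v w s p q r)"
proof -
  have w: "w = 1 / (u * v)" using weights by (simp add: field_simps)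
  have "skew_symmetrizable (weighted_exchange u v w s p q r)"
    unfolding weighted_exchange_def
    \<comment> \<open>Normalizing the last diagonal entry to 1, the conditions on the
      \<open>p\<close> and \<open>q\<close> entries give \<open>u\<^sup>2\<close> and
      \<open>1 / v\<^sup>2\<close>; the remaining one becomes (u v w)^2 = 1.\<close>
    by (rule skew_symmetrizable_exchange_matrix[of "1 / v\<^sup>2" "u\<^sup>2" 1])
      (use weights(1,2) in \<open>simp_all add: w field_simps power2_eq_square\<close>)
  then show ?thesis
    using assms weights(1-3)
    unfolding weighted_exchange_def cyclic_exchange_matrix_iff by auto
qed

text \<open>A mutation leaves two of the three numbers positive, so cyclicity of the result forces
  the new one to be positive.\<close>

lemma cyclic_weighted_exchange_same_sign:
  assumes "cyclic (weighted_exchange u v w s p q r)" "s = 1 \<or> s = - 1"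
  shows "0 < p \<and> 0 < q \<and> 0 < r \<or> p < 0 \<and> q < 0 \<and> r < 0"
  using assms weights(1-3)
  unfolding weighted_exchange_def cyclic_exchange_matrix_iff
  by (auto simp: zero_less_mult_iff mult_less_0_iff zero_less_divide_iff)

end

section \<open>Cluster-cyclic matrices\<close>

text \<open>The inductive definition appends mutations at the end; this prepends one.\<close>

lemma mutation_equivalent_mutation:
  assumes "mutation_equivalent (mutation k B) B'"
  shows "mutation_equivalent B B'"
  using assms by induction (auto intro: mutation_equivalent.intros)

lemma cluster_cyclic_mutation: "cluster_cyclic B \<Longrightarrow> cluster_cyclic (mutation k B)"
  by (auto simp: cluster_cyclic_def dest: mutation_equivalent_mutation)

lemma cluster_cyclic_imp_cyclic: "cluster_cyclic B \<Longrightarrow> cyclic B"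
  by (simp add: cluster_cyclic_def mutation_equivalent.refl)

text \<open>The weights stay fixed, while \<open>s\<close> is quantified inside the predicate
  because each mutation flips it.\<close>

lemma positive_mutation_closed_cluster_cyclic:
  assumes "0 < u" "0 < v" "0 < w" "u * v * w = 1"
  shows "positive_mutation_closed (\<lambda>p q r. 0 < p \<and> 0 < q \<and> 0 < r \<and>
    (\<exists>s. (s = 1 \<or> s = - 1) \<and> cluster_cyclic (weighted_exchange u v w s p q r)))"
  unfolding positive_mutation_closed_def
proof (intro allI impI, elim conjE exE)
  fix p q r s
  assume pos: "0 < p" "0 < q" "0 < r" and s: "s = 1 \<or> s = - 1"
    and "cluster_cyclic (weighted_exchange u v w s p q r)"
  then have cc: "cluster_cyclic (weighted_exchange u v w (- s) (q * r - p) q r)"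
    "cluster_cyclic (weighted_exchange u v w (- s) p (p * r - q) r)"
    "cluster_cyclic (weighted_exchange u v w (- s) p q (p * q - r))"
    using cluster_cyclic_mutation mutation_weighted_exchange[OF assms s pos] by metis+
  have s': "- s = 1 \<or> - s = - 1" using s by auto
  note same_sign = cyclic_weighted_exchange_same_sign[OF assms cluster_cyclic_imp_cyclic s']
  have "0 < q * r - p" "0 < p * r - q" "0 < p * q - r"
    using cc[THEN same_sign] pos by auto
  then show "0 < p \<and> 0 < q \<and> 0 < r \<and>
    (0 < q * r - p \<and> 0 < q \<and> 0 < r \<and>
      (\<exists>s. (s = 1 \<or> s = - 1) \<and> cluster_cyclic (weighted_exchange u v w s (q * r - p) q r))) \<and>
    (0 < p \<and> 0 < p * r - q \<and> 0 < r \<and>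
      (\<exists>s. (s = 1 \<or> s = - 1) \<and> cluster_cyclic (weighted_exchange u v w s p (p * r - q) r))) \<and>
    (0 < p \<and> 0 < q \<and> 0 < p * q - r \<and>
      (\<exists>s. (s = 1 \<or> s = - 1) \<and> cluster_cyclic (weighted_exchange u v w s p q (p * q - r))))"
    using cc pos s' by blast
qed

lemma cluster_cyclic_weighted_exchange:
  assumes weights: "0 < u" "0 < v" "0 < w" "u * v * w = 1"
    and "s = 1 \<or> s = - 1" "2 \<le> p" "2 \<le> q" "2 \<le> r" "markov_form p q r \<le> 4"
  shows "cluster_cyclic (weighted_exchange u v w s p q r)"
proof -
  \<comment> \<open>An invariant of the whole mutation class: only the sign and the triple
    vary.\<close>
  let ?good = "\<lambda>B'. \<exists>s p q r. (s = 1 \<or> s = - 1) \<and> 2 \<le> p \<and> 2 \<le> q \<and> 2 \<le> r \<and>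
    markov_form p q r \<le> 4 \<and> B' = weighted_exchange u v w s p q r"
  have "?good B'" if "mutation_equivalent (weighted_exchange u v w s p q r) B'" for B'
    using that
  proof induction
    case refl
    then show ?case using assms by blast
  next
    case (step B' k)
    then obtain s p q r where s: "s = 1 \<or> s = - 1" and ge: "2 \<le> p" "2 \<le> q" "2 \<le> r"
      and form: "markov_form p q r \<le> 4" and B': "B' = weighted_exchange u v w s p q r"
      by blast
    have pos: "0 < p" "0 < q" "0 < r" using ge by auto
    have s': "- s = 1 \<or> - s = - 1" using s by auto
    have "2 \<le> q * r - p" "2 \<le> p * r - q" "2 \<le> p * q - r"
      using two_le_mutate[of p q r] two_le_mutate[of q p r] two_le_mutate[of r p q] ge form
      by (simp_all add: markov_form_swap)
    then show ?case
      using exhaust_3[of k] mutation_weighted_exchange[OF weights s pos] s' ge form B'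
        markov_form_mutate[of q r p] markov_form_mutate'[of p r q] markov_form_mutate'(2)[of p q r]
      by metis
  qed
  then show ?thesis
    unfolding cluster_cyclic_def using cyclic_weighted_exchange[OF weights] by fastforce
qed

lemma cluster_cyclic_weighted_exchange_iff:
  assumes weights: "0 < u" "0 < v" "0 < w" "u * v * w = 1"
    and s: "s = 1 \<or> s = - 1" and pos: "0 < p" "0 < q" "0 < r"
  shows "cluster_cyclic (weighted_exchange u v w s p q r) \<longleftrightarrow>
    markov_form p q r \<le> 4 \<and> 2 \<le> p \<and> 2 \<le> q \<and> 2 \<le> r"
proof
  assume cc: "cluster_cyclic (weighted_exchange u v w s p q r)"
  define P where "P p q r \<longleftrightarrow> 0 < p \<and> 0 < q \<and> 0 < r \<and>
    (\<exists>s. (s = 1 \<or> s = - 1) \<and> cluster_cyclic (weighted_exchange u v w s p q r))" for p q r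
  have closed: "positive_mutation_closed P"
    using positive_mutation_closed_cluster_cyclic[OF weights] unfolding P_def .
  have P: "P p q r" unfolding P_def using cc s pos by blast
  show "markov_form p q r \<le> 4 \<and> 2 \<le> p \<and> 2 \<le> q \<and> 2 \<le> r"
    using positive_mutation_closed_markov_form_le[OF closed P]
      positive_mutation_closed_all_ge_two[OF closed P] by blast
qed (use cluster_cyclic_weighted_exchange[OF weights s] in blast)

text \<open>The equation s p u = x dictates u = s x / p, and then s p / u = p^2 / x = x'. The
  weights multiply to 1 because p q r is the square root of (x y z) (x' y' z'), which is |x y
  z|.\<close>

lemma exchange_matrix_eq_weighted_exchange:
  assumes s: "s = 1 \<or> s = - 1"
    and signs: "0 < s * x" "0 < s * y" "0 < s * z" "0 < s * x'" "0 < s * y'" "0 < s * z'"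
    and prod_eq: "x * y * z = x' * y' * z'"
  defines "p \<equiv> sqrt (x * x')" and "q \<equiv> sqrt (y * y')" and "r \<equiv> sqrt (z * z')"
  obtains u v w where "0 < u" "0 < v" "0 < w" "u * v * w = 1"
    "exchange_matrix x y z x' y' z' = weighted_exchange u v w s p q r"
    "0 < p" "0 < q" "0 < r" "p * q * r = \<bar>x * y * z\<bar>"
proof -
  have prods: "0 < x * x'" "0 < y * y'" "0 < z * z'"
    using s signs by (auto intro: mult_pos_pos mult_neg_neg)
  have pos: "0 < p" "0 < q" "0 < r" using prods by (simp_all add: p_def q_def r_def)
  have sq: "p * p = x * x'" "q * q = y * y'" "r * r = z * z'"
    using prods by (simp_all add: p_def q_def r_def)
  have "p * q * r = sqrt ((x * y * z) * (x' * y' * z'))"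
    unfolding p_def q_def r_def real_sqrt_mult[symmetric] by (simp add: mult_ac)
  then have pqr: "p * q * r = \<bar>x * y * z\<bar>"
    unfolding prod_eq[symmetric] by simp
  have "0 < (s * x) * (s * y) * (s * z)" using signs by simp
  then have abs: "\<bar>x * y * z\<bar> = s * x * (s * y) * (s * z)" using s by auto
  show ?thesis
  proof (rule that[of "s * x / p" "s * y / q" "s * z / r"])
    show "0 < s * x / p" "0 < s * y / q" "0 < s * z / r" using signs pos by simp_all
    have "s * x / p * (s * y / q) * (s * z / r) = \<bar>x * y * z\<bar> / (p * q * r)"
      unfolding abs by simp
    also have "\<dots> = 1" unfolding pqr[symmetric] using pos by simp
    finally show "s * x / p * (s * y / q) * (s * z / r) = 1" .
    have scale: "s * a * (s * b / a) = b \<and> s * a / (s * b / a) = b'"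
      if "0 < a" "a * a = b * b'" "0 < s * b" for a b b'
    proof -
      have "b \<noteq> 0" using that(3) by auto
      moreover have "s * a * (s * b / a) = b" "s * a / (s * b / a) = a * a / b"
        using s that(1) by auto
      ultimately show ?thesis unfolding that(2) by simp
    qed
    show "exchange_matrix x y z x' y' z' =
        weighted_exchange (s * x / p) (s * y / q) (s * z / r) s p q r"
      unfolding weighted_exchange_def exchange_matrix_eq_iff
      using scale[OF pos(1) sq(1)] scale[OF pos(2) sq(2)] scale[OF pos(3) sq(3)] signs by simp
  qed (use pos pqr in auto)
qed

theorem theorem1p2:
  fixes B :: "real^3^3" and x y z x' y' z' :: real
  assumes "skew_symmetrizable B"
    and "cyclic B"
    and "B = exchange_matrix x y z x' y' z'"
    and "x * y * z = x' * y' * z'"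
  shows "cluster_cyclic B \<longleftrightarrow>
    markov_constant B \<le> 4 \<and> x * x' \<ge> 4 \<and> y * y' \<ge> 4 \<and> z * z' \<ge> 4"
proof -
  obtain s :: real where s: "s = 1 \<or> s = - 1"
    and signs: "0 < s * x" "0 < s * y" "0 < s * z" "0 < s * x'" "0 < s * y'" "0 < s * z'"
  proof -
    \<comment> \<open>The factors \<open>1\<close> and \<open>- 1\<close> display the two candidates
      for \<open>s\<close>.\<close>
    have "0 < 1 * x \<and> 0 < 1 * y \<and> 0 < 1 * z \<and> 0 < 1 * x' \<and> 0 < 1 * y' \<and> 0 < 1 * z' \<or>
      0 < - 1 * x \<and> 0 < - 1 * y \<and> 0 < - 1 * z \<and> 0 < - 1 * x' \<and> 0 < - 1 * y' \<and> 0 < - 1 * z'"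
      using assms(2) unfolding assms(3) cyclic_exchange_matrix_iff by auto
    then show ?thesis using that by blast
  qed
  define p q r where "p = sqrt (x * x')" and "q = sqrt (y * y')" and "r = sqrt (z * z')"
  obtain u v w where weights: "0 < u" "0 < v" "0 < w" "u * v * w = 1"
    and B: "B = weighted_exchange u v w s p q r"
    and pos: "0 < p" "0 < q" "0 < r" and pqr: "p * q * r = \<bar>x * y * z\<bar>"
    using exchange_matrix_eq_weighted_exchange[OF s signs assms(4)]
    unfolding assms(3) p_def q_def r_def by metis
  have sq: "p\<^sup>2 = x * x'" "q\<^sup>2 = y * y'" "r\<^sup>2 = z * z'"
    using pos by (simp_all add: p_def q_def r_def)
  have "markov_constant B = markov_form p q r"
    unfolding assms(3) markov_constant_exchange_matrix markov_form_def sq pqr ..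
  moreover have "2 \<le> a \<longleftrightarrow> 4 \<le> a\<^sup>2" if "0 < a" for a :: real
    using abs_le_square_iff[of 2 a] that by simp
  ultimately show ?thesis
    using cluster_cyclic_weighted_exchange_iff[OF weights s pos] pos
    unfolding B[symmetric] sq[symmetric] by simp
qed

end
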